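(* Fix constants $a>0$, $b>0$. Let $\mathcal F\colon\mathbb R^{2N}\to\overline{\mathbb R}$ be a proper lower semi-continuous function which has the Kurdyka–Łojasiewicz (KL) property at some local (or global) minimizer $z^*=(x^*,x^* )$ of $\mathcal F$. Assume that the following growth condition holds for $\mathcal F$ at $z^*=(z_1^*,z_2^* )$ (with this constant $a$): for any $\delta>0$ there exist $0<\rho<\delta$ and $\nu>0$ such that $$z\in B_\rho(z^* ),\ \mathcal F(z)<\mathcal F(z^* )+\nu,\ y=(y_1,y_2)\in\mathbb R^{2N},\ y_2\notin B_\delta(z_2^* )\ \Rightarrow\ \mathcal F(z)<\mathcal F(y)+\tfrac a4|z_2-y_2|^2.$$ Then, for any $r>0$, there exist $u\in(0,r)$ and $\mu>0$ such that the conditions $$z^0\in B_u(z^* ),\qquad \mathcal F(z^* )<\mathcal F(z^0)<\mathcal F(z^* )+\mu,$$ imply that any sequence $(z^k)_{k\ge 0}$, $z^k=(x^k,x^{k-1})$, that starts at $z^0$ and satisfies, for each $k\ge0$, the sufficient descent condition $$\mathcal F(z^{k+1})+a|x^k-x^{k-1}|^2\le\mathcal F(z^k)$$ and the relative error condition that there exists $w^{k+1}\in\partial\mathcal F(z^{k+1})$ with $$|w^{k+1}|\le\tfrac b2\bigl(|x^k-x^{k-1}|+|x^{k+1}-x^k|\bigr)$$ has the finite length property $$\sum_{k=1}^\infty |x^k-x^{k-1}|<+\infty,$$ remains in $B_r(z^* )$, and converges to some $\bar z\in B_r(z^* )$, a critical point of $\mathcal F$ with $\mathcal F(\bar z)=\mathcal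 F(z^* )$. For $r$ sufficiently small, $\bar z$ is a local minimizer of $\mathcal F$.
   Context: $|\cdot|$ is the Euclidean norm, $\overline{\mathbb R}=\mathbb R\cup\{+\infty\}$, $B_\varepsilon(\bar x)=\{x: |x-\bar x|\le\varepsilon\}$. For $z\in\mathbb R^{2N}$ write $z=(z_1,z_2)$ with $z_1,z_2\in\mathbb R^N$. Subdifferential: for $f\colon\mathbb R^n\to\overline{\mathbb R}$ and $\bar x\in\operatorname{dom}f$ the Fréchet subdifferential $\widehat\partial f(\bar x)$ is the set of $v$ with $\liminf_{x\to\bar x,x\ne\bar x}\frac{f(x)-f(\bar x)-\langle v,x-\bar x\rangle}{|x-\bar x|}\ge 0$, and the limiting subdifferential $\partial f(\bar x)$ is the set of $v$ for which there are $x^n\to\bar x$ with $f(x^n)\to f(\bar x)$ and $v^n\in\widehat\partial f(x^n)$ with $v^n\to v$; both are empty if $\bar x\notin\operatorname{dom}f$. A critical point is a point $\bar x\in\operatorname{dom} f$ with $0\in\partial f(\bar x)$. KL property: $f\colon\mathbb R^n\to\overline{\mathbb R}$ has the KL property at $\bar x\in\operatorname{dom}\partial f$ if there exist $\eta\in(0,\infty]$, a neighborhood $U$ of $\bar x$ and a continuous concave function $\varphi\colon[0,\eta)\to\mathbb R_+$ with $\varphi(0)=0$, $\varphi\in C^1((0,\eta))$, $\varphi'(s)>0$ for all $s\in(0,\eta)$, such that $\varphi'(f(x)-f(\bar x))\cdot\inf_{v\in\partial f(x)}|v|\ge 1$ for all $x\in U$ with $f(\bar x)<f(x)<f(\bar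 x)+\eta$ (with $\inf\emptyset=+\infty$). The sequences considered arise from a sequence $(x^k)_{k\ge -1}$ in $\mathbb R^N$ by setting $z^k=(x^k,x^{k-1})\in\mathbb R^{2N}$, $k\ge 0$. *)

theory Defs
  imports "HOL-Analysis.Analysis"
begin

text \<open>
  Functions into \<open>\<real> \<union> {+\<infinity>}\<close> are functions into \<^typ>\<open>ereal\<close>; the value \<open>-\<infinity>\<close> is
  excluded by \<open>proper_fun\<close>. On products the norm and inner product of the library are the
  Euclidean ones, so \<open>'b \<times> 'b\<close> with \<open>'b = real ^ 'n\<close> is Euclidean space of dimension \<open>2 N\<close>.
\<close>

definition proper_fun :: "('a \<Rightarrow> ereal) \<Rightarrow> bool" where
  "proper_fun f \<longleftrightarrow> (\<forall>x. f x \<noteq> -\<infinity>) \<and> (\<exists>x. f x < \<infinity>)"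

definition effective_domain :: "('a \<Rightarrow> ereal) \<Rightarrow> 'a set" where
  "effective_domain f = {x. f x < \<infinity>}"

definition lower_semicontinuous :: "('a::topological_space \<Rightarrow> ereal) \<Rightarrow> bool" where
  "lower_semicontinuous f \<longleftrightarrow> (\<forall>x. f x \<le> Liminf (at x) f)"

definition frechet_subdifferential ::
  "('a::euclidean_space \<Rightarrow> ereal) \<Rightarrow> 'a \<Rightarrow> 'a set" where
  "frechet_subdifferential f x =
     {v. x \<in> effective_domain f \<and>
         Liminf (at x) (\<lambda>y. (f y - f x - ereal (v \<bullet> (y - x))) / ereal (norm (y - x))) \<ge> 0}"

definition limiting_subdifferential ::
  "('a::euclidean_space \<Rightarrow> ereal) \<Rightarrow> 'a \<Rightarrow> 'a set" where
  "limiting_subdifferential f x =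
     {v. x \<in> effective_domain f \<and>
         (\<exists>xs vs. xs \<longlonglongrightarrow> x \<and> (\<lambda>n. f (xs n)) \<longlonglongrightarrow> f x \<and>
            (\<forall>n::nat. vs n \<in> frechet_subdifferential f (xs n)) \<and> vs \<longlonglongrightarrow> v)}"

definition critical_point :: "('a::euclidean_space \<Rightarrow> ereal) \<Rightarrow> 'a \<Rightarrow> bool" where
  "critical_point f x \<longleftrightarrow> x \<in> effective_domain f \<and> 0 \<in> limiting_subdifferential f x"

definition local_minimizer :: "('a::topological_space \<Rightarrow> ereal) \<Rightarrow> 'a \<Rightarrow> bool" where
  "local_minimizer f x \<longleftrightarrow> x \<in> effective_domain f \<and> (\<forall>\<^sub>F y in nhds x. f x \<le> f y)"

text \<open>
  The \<open>\<phi>\<close> below is a total function of which only the values on \<open>[0, \<eta>)\<close> matter, with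
  \<open>\<eta> = \<infinity>\<close> allowed. The infimum of the empty set in \<^typ>\<open>ereal\<close> is \<open>\<infinity>\<close>.
\<close>

definition desingularizing :: "ereal \<Rightarrow> (real \<Rightarrow> real) \<Rightarrow> bool" where
  "desingularizing \<eta> \<phi> \<longleftrightarrow>
     continuous_on {s. 0 \<le> s \<and> ereal s < \<eta>} \<phi> \<and>
     concave_on {s. 0 \<le> s \<and> ereal s < \<eta>} \<phi> \<and>
     (\<forall>s. 0 \<le> s \<and> ereal s < \<eta> \<longrightarrow> 0 \<le> \<phi> s) \<and>
     \<phi> 0 = 0 \<and>
     (\<forall>s. 0 < s \<and> ereal s < \<eta> \<longrightarrow> \<phi> differentiable (at s)) \<and>
     continuous_on {s. 0 < s \<and> ereal s < \<eta>} (deriv \<phi>) \<and>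
     (\<forall>s. 0 < s \<and> ereal s < \<eta> \<longrightarrow> 0 < deriv \<phi> s)"

definition KL_property :: "('a::euclidean_space \<Rightarrow> ereal) \<Rightarrow> 'a \<Rightarrow> bool" where
  "KL_property f x \<longleftrightarrow>
     limiting_subdifferential f x \<noteq> {} \<and>
     (\<exists>\<eta> U \<phi>. 0 < \<eta> \<and> open U \<and> x \<in> U \<and> desingularizing \<eta> \<phi> \<and>
        (\<forall>y\<in>U. f x < f y \<and> f y < f x + \<eta> \<longrightarrow>
           ereal (deriv \<phi> (real_of_ereal (f y - f x))) *
             (INF v\<in>limiting_subdifferential f y. ereal (norm v)) \<ge> 1))"

definition growth_condition ::
  "real \<Rightarrow> ('b::euclidean_space \<times> 'b \<Rightarrow> ereal) \<Rightarrow> 'b \<times> 'b \<Rightarrow> bool" where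
  "growth_condition a F zs \<longleftrightarrow>
     (\<forall>\<delta>>0. \<exists>\<rho> \<nu>. 0 < \<rho> \<and> \<rho> < \<delta> \<and> 0 < \<nu> \<and>
        (\<forall>z y. z \<in> cball zs \<rho> \<and> F z < F zs + ereal \<nu> \<and> snd y \<notin> cball (snd zs) \<delta> \<longrightarrow>
           F z < F y + ereal (a / 4 * (norm (snd z - snd y))\<^sup>2)))"

text \<open>
  A sequence \<open>(x\<^sup>k)\<close>, \<open>k \<ge> -1\<close>, is modelled by \<open>x :: int \<Rightarrow> 'b\<close>; the entries below index \<open>-1\<close>
  are never used.
\<close>

definition lifted_seq :: "(int \<Rightarrow> 'b) \<Rightarrow> nat \<Rightarrow> 'b \<times> 'b" where
  "lifted_seq x k = (x (int k), x (int k - 1))"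

definition sufficient_descent ::
  "real \<Rightarrow> ('b::euclidean_space \<times> 'b \<Rightarrow> ereal) \<Rightarrow> (int \<Rightarrow> 'b) \<Rightarrow> bool" where
  "sufficient_descent a F x \<longleftrightarrow>
     (\<forall>k. F (lifted_seq x (Suc k)) + ereal (a * (norm (x (int k) - x (int k - 1)))\<^sup>2)
            \<le> F (lifted_seq x k))"

definition relative_error ::
  "real \<Rightarrow> ('b::euclidean_space \<times> 'b \<Rightarrow> ereal) \<Rightarrow> (int \<Rightarrow> 'b) \<Rightarrow> bool" where
  "relative_error b F x \<longleftrightarrow>
     (\<forall>k. \<exists>w \<in> limiting_subdifferential F (lifted_seq x (Suc k)).
        norm w \<le> b / 2 * (norm (x (int k) - x (int k - 1)) + norm (x (int k + 1) - x (int k))))"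

end

theory Submission
  imports Defs
begin

text \<open>
  Write \<open>z\<^sup>k = (x\<^sup>k, x\<^sup>k\<^sup>-\<^sup>1)\<close> and \<open>\<Delta>\<^sub>k = |x\<^sup>k - x\<^sup>k\<^sup>-\<^sup>1|\<close>. As long as \<open>z\<^sup>j\<close> and \<open>z\<^sup>j\<^sup>+\<^sup>1\<close> lie in a neighbourhood of
  \<open>z\<^sup>*\<close> on which \<open>F \<ge> F(z\<^sup>*)\<close> and the KL inequality holds, concavity of \<open>\<phi>\<close> and the arithmetic-geometric
  mean inequality give \<open>3 \<Delta>\<^sub>j \<le> (2 b / a) (\<phi>(F(z\<^sup>j) - F(z\<^sup>*)) - \<phi>(F(z\<^sup>j\<^sup>+\<^sup>1) - F(z\<^sup>*))) + \<Delta>\<^sub>j\<^sub>-\<^sub>1\<close>,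
  which telescopes. To use it up to the next iterate one needs two further points in the
  neighbourhood. If \<open>z\<^sup>k\<close> is close to \<open>z\<^sup>*\<close>, then \<open>y = z\<^sup>k\<^sup>+\<^sup>2\<close> and \<open>y = z\<^sup>k\<^sup>+\<^sup>3\<close> violate the conclusion of
  the growth condition, because \<open>|x\<^sup>k\<^sup>-\<^sup>1 - x\<^sup>k\<^sup>+\<^sup>m\<^sup>-\<^sup>1|\<^sup>2\<close> is at most \<open>m\<close> times the sum of the \<open>m\<close> squared
  steps and \<open>m \<le> 4\<close>; hence \<open>x\<^sup>k\<^sup>+\<^sup>1\<close> and \<open>x\<^sup>k\<^sup>+\<^sup>2\<close> stay near \<open>x\<^sup>*\<close>. By induction the whole sequence is trapped.
  Its limit has the value \<open>F(z\<^sup>*)\<close> and lies inside the neighbourhood, so it is itself a local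
  minimizer and therefore critical.
\<close>

lemma desingularizing_above_tangent:
  assumes "desingularizing \<eta> \<phi>" and "0 < s" "ereal s < \<eta>" and "0 \<le> t" "ereal t < \<eta>"
  shows "deriv \<phi> s * (s - t) \<le> \<phi> s - \<phi> t"
proof -
  define A where "A = {s. 0 \<le> s \<and> ereal s < \<eta>}"
  have iv: "is_interval A"
    unfolding is_interval_1
  proof (intro ballI allI impI)
    fix p q r assume "p \<in> A" "q \<in> A" "p \<le> r \<and> r \<le> q"
    then show "r \<in> A"
      using le_less_trans[of "ereal r" "ereal q" \<eta>] by (simp add: A_def)
  qed
  \<comment> \<open>\<open>\<eta>\<close> may be infinite, so a real \<open>e\<close> below it
    bounds an open interval around \<open>s\<close>.\<close>
  obtain e where e: "s < e" "ereal e < \<eta>"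
    using ereal_dense2[OF assms(3)] by auto
  have "{0<..<e} \<subseteq> A"
  proof
    fix p assume "p \<in> {0<..<e}"
    then show "p \<in> A"
      using e less_trans[of "ereal p" "ereal e" \<eta>] by (simp add: A_def)
  qed
  then have "s \<in> interior A"
    using assms(2) e(1) by (intro interiorI[of "{0<..<e}"]) simp_all
  moreover have "convex_on A (\<lambda>s. - \<phi> s)"
    using assms(1) by (simp add: desingularizing_def concave_on_def A_def)
  moreover have "connected A" using iv by (simp add: is_interval_connected)
  moreover have "t \<in> A" using assms by (simp add: A_def)
  moreover have "((\<lambda>s. - \<phi> s) has_field_derivative - deriv \<phi> s) (at s within A)"
  proof -
    have "\<phi> differentiable (at s)" using assms by (simp add: desingularizing_def)
    then have "(\<phi> has_real_derivative deriv \<phi> s) (at s)"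
      using DERIV_deriv_iff_real_differentiable by blast
    then show ?thesis
      by (intro DERIV_minus) (rule has_field_derivative_at_within)
  qed
  ultimately have "- \<phi> t - (- \<phi> s) \<ge> - deriv \<phi> s * (t - s)"
    by (intro convex_on_imp_above_tangent)
  then show ?thesis by (simp add: algebra_simps)
qed

text \<open>Here \<open>d0\<close>, \<open>d1\<close> are consecutive step lengths, \<open>p\<close>
  is the slope of \<open>\<phi>\<close>, and \<open>s\<close> and \<open>P\<close> stand for the
  drops of the gap and of its image under \<open>\<phi>\<close>. Multiplying descent by the KL bound
  gives \<open>2 * d1\<^sup>2 \<le> Q * S\<close>; the arithmetic-geometric mean inequality then
  removes the squares.\<close>

lemma KL_step:
  fixes a b d0 d1 p s P :: real
  assumes "0 < a" "0 < b" "0 \<le> d0" "0 \<le> d1"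
    and kl: "1 \<le> p * (b / 2 * (d0 + d1))" and p: "0 < p"
    and descent: "a * d1\<^sup>2 \<le> s" and P: "p * s \<le> P"
  shows "3 * d1 \<le> 2 * (b / a * P) + d0"
proof -
  define S where "S = d0 + d1"
  define Q where "Q = b / a * P"
  have S: "0 \<le> S" using assms by (simp add: S_def)
  have "2 * d1\<^sup>2 \<le> Q * S"
  proof -
    have "a * d1\<^sup>2 \<le> (a * d1\<^sup>2) * (p * (b / 2 * S))"
      using mult_left_mono[OF kl, of "a * d1\<^sup>2"] \<open>0 < a\<close> by (simp add: S_def)
    also have "\<dots> = (p * (a * d1\<^sup>2)) * (b / 2 * S)" by simp
    also have "\<dots> \<le> P * (b / 2 * S)"
    proof (rule mult_right_mono)
      show "p * (a * d1\<^sup>2) \<le> P"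
        using mult_left_mono[OF descent, of p] p P by linarith
    qed (use S assms in simp)
    finally show ?thesis using \<open>0 < a\<close> by (simp add: Q_def field_simps)
  qed
  moreover have "8 * (Q * S) \<le> (2 * Q + S)\<^sup>2"
    using zero_le_power2[of "2 * Q - S"] by (simp add: power2_eq_square algebra_simps)
  ultimately have "(4 * d1)\<^sup>2 \<le> (2 * Q + S)\<^sup>2" by (simp add: power_mult_distrib)
  \<comment> \<open>The sign of \<open>2 * Q + S\<close> is needed to take square roots.\<close>
  moreover have "0 \<le> Q"
  proof -
    have "0 \<le> a * d1\<^sup>2" using \<open>0 < a\<close> by simp
    then have "0 \<le> p * s" using descent p by simp
    then have "0 \<le> P" using P by linarith
    then show ?thesis using assms by (simp add: Q_def)
  qed
  ultimately have "4 * d1 \<le> 2 * Q + S"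
    using power2_le_imp_le[of "4 * d1" "2 * Q + S"] S by simp
  then show ?thesis by (simp add: Q_def S_def)
qed

text \<open>One of the three copies of \<open>d (Suc j)\<close> pays for the term \<open>d j\<close>
  of the next inequality; this is why \<open>d n\<close> is kept on the left.\<close>

lemma sum_le_telescope:
  fixes d Q :: "nat \<Rightarrow> real"
  assumes "\<And>j. j < n \<Longrightarrow> 3 * d (Suc j) \<le> 2 * (Q j - Q (Suc j)) + d j"
  shows "2 * (\<Sum>j<n. d (Suc j)) + d n \<le> 2 * (Q 0 - Q n) + d 0"
  using assms
proof (induction n)
  case (Suc n)
  have "2 * (\<Sum>j<n. d (Suc j)) + d n \<le> 2 * (Q 0 - Q n) + d 0"
    using Suc by simp
  then show ?case using Suc.prems[of n] by simp
qed simp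

lemma sum_squares2_le: "(p + q)\<^sup>2 \<le> 2 * (p\<^sup>2 + q\<^sup>2)" for p q :: real
  using zero_le_power2[of "p - q"] by (simp add: power2_eq_square algebra_simps)

lemma sum_squares3_le: "(p + q + r)\<^sup>2 \<le> 3 * (p\<^sup>2 + q\<^sup>2 + r\<^sup>2)" for p q r :: real
  using zero_le_power2[of "p - q"] zero_le_power2[of "p - r"] zero_le_power2[of "q - r"]
  by (simp add: power2_eq_square algebra_simps)

lemma dist_le_sum_steps:
  fixes y :: "nat \<Rightarrow> 'a::metric_space"
  shows "dist (y (m + n)) c \<le> dist (y m) c + (\<Sum>j<n. dist (y (Suc (m + j))) (y (m + j)))"
proof (induction n)
  case (Suc n)
  then show ?case
    using dist_triangle[of "y (Suc (m + n))" c "y (m + n)"] by simp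
qed simp

lemma summable_norm_steps_imp_convergent:
  fixes y :: "nat \<Rightarrow> 'a::banach"
  assumes "summable (\<lambda>n. norm (y (Suc n) - y n))"
  shows "convergent y"
proof -
  have "summable (\<lambda>n. y (Suc n) - y n)"
    using assms by (rule summable_norm_cancel)
  then show ?thesis
    by (simp add: summable_iff_convergent sum_lessThan_telescope convergent_diff_const_right_iff)
qed

lemma lower_semicontinuous_le_lim:
  fixes f :: "'a::topological_space \<Rightarrow> ereal"
  assumes "lower_semicontinuous f" and z: "z \<longlonglongrightarrow> x" and fz: "(\<lambda>n. f (z n)) \<longlonglongrightarrow> l"
  shows "f x \<le> l"
proof (rule ccontr)
  assume "\<not> f x \<le> l"
  then obtain c where c: "l < c" "c < f x" using dense by (metis not_le)
  have "c < Liminf (at x) f"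
    using assms(1) c by (auto simp: lower_semicontinuous_def intro: less_le_trans)
  then have "\<forall>\<^sub>F y in at x. c < f y" using less_LiminfD by blast
  \<comment> \<open>\<open>Liminf (at x)\<close> ignores \<open>x\<close> itself;
    \<open>c < f x\<close> covers terms of the sequence that equal the limit.\<close>
  then have "\<forall>\<^sub>F y in nhds x. c < f y"
    using c by (auto simp: eventually_at_filter elim: eventually_mono)
  then have "\<forall>\<^sub>F n in sequentially. c < f (z n)"
    using z unfolding filterlim_iff by blast
  moreover have "\<forall>\<^sub>F n in sequentially. f (z n) < c"
    using order_tendstoD(2)[OF fz c(1)] .
  ultimately have "\<forall>\<^sub>F n in sequentially. False"
    by eventually_elim auto
  then show False by simp
qed

text \<open>Fermat's rule: the difference quotients for \<open>v = 0\<close> are nonnegative near a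
  minimizer, and constant sequences turn the Frechet subgradient into a limiting one.\<close>

lemma local_minimizer_imp_critical_point:
  assumes "proper_fun f" and min: "local_minimizer f x"
  shows "critical_point f x"
proof -
  have dom: "x \<in> effective_domain f" using min by (simp add: local_minimizer_def)
  have ninf: "f x \<noteq> - \<infinity>" using assms by (simp add: proper_fun_def)
  have "\<forall>\<^sub>F y in at x. f x \<le> f y"
    using min by (auto simp: local_minimizer_def eventually_at_filter elim: eventually_mono)
  then have "\<forall>\<^sub>F y in at x. 0 \<le> (f y - f x - ereal (0 \<bullet> (y - x))) / ereal (norm (y - x))"
  proof eventually_elim
    case (elim y)
    have "0 \<le> f y - f x"
      using elim dom ninf by (cases "f x"; cases "f y") (auto simp: effective_domain_def)
    \<comment> \<open>For \<open>y = x\<close> the quotient is 0 / 0, which is 0 in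
      \<open>ereal\<close>.\<close>
    then show ?case
      by (cases "y = x") (auto intro!: zero_le_divide_ereal)
  qed
  then have "0 \<le> Liminf (at x) (\<lambda>y. (f y - f x - ereal (0 \<bullet> (y - x))) / ereal (norm (y - x)))"
    by (rule Liminf_bounded)
  then have "0 \<in> frechet_subdifferential f x"
    using dom by (simp add: frechet_subdifferential_def)
  then have "0 \<in> limiting_subdifferential f x"
    using dom unfolding limiting_subdifferential_def
    by (intro CollectI conjI exI[of _ "\<lambda>_. x"] exI[of _ "\<lambda>_. 0"]) simp_all
  then show ?thesis using dom by (simp add: critical_point_def)
qed

lemma dist_Pair_le: "dist (p, q) (p', q') \<le> dist p p' + dist q q'"
  by (simp add: dist_Pair_Pair sqrt_sum_squares_le_sum)

text \<open>Replaces the infimum in the KL inequality by the single subgradient that the relative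
  error condition supplies.\<close>

lemma KL_ineq_at_subgradient:
  assumes "1 \<le> ereal p * (INF v\<in>S. ereal (norm v))" and "w \<in> S" and "0 < p"
  shows "1 \<le> p * norm w"
proof -
  have "(INF v\<in>S. ereal (norm v)) \<le> ereal (norm w)"
    using assms(2) by (rule INF_lower)
  then have "ereal p * (INF v\<in>S. ereal (norm v)) \<le> ereal p * ereal (norm w)"
    using assms(3) by (intro ereal_mult_left_mono) auto
  with assms(1) have "(1::ereal) \<le> ereal p * ereal (norm w)" by (rule order_trans)
  then show ?thesis by (simp add: one_ereal_def)
qed

text \<open>Strong induction: while \<open>y 0\<close>, ..., \<open>y k\<close> lie in the
  \<open>\<sigma>\<close>-ball, the telescoped steps from \<open>y 1\<close> to
  \<open>y (k + 1)\<close> add up to at most \<open>\<sigma> / 2\<close>, so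
  \<open>y (k + 1)\<close> is within \<open>\<sigma> / 4 + \<sigma> / 2\<close> of
  \<open>c\<close>.\<close>

lemma iterates_trapped:
  fixes y :: "nat \<Rightarrow> 'a::real_normed_vector" and g Q :: "nat \<Rightarrow> real"
  assumes "0 < a" "0 < \<sigma>"
    and y0: "dist (y 0) c \<le> \<sigma> / 4" and y1: "dist (y 1) c \<le> \<sigma> / 4"
    and descent: "g 1 + a * (norm (y 1 - y 0))\<^sup>2 \<le> g 0"
    and g0: "g 0 \<le> a * (\<sigma> / 4)\<^sup>2" and g1: "0 \<le> g 1" and Q0: "Q 0 \<le> \<sigma> / 4"
    and step: "\<And>k. dist (y k) c \<le> \<sigma> \<Longrightarrow> dist (y (Suc k)) c \<le> \<sigma> \<Longrightarrow>
      0 \<le> Q (Suc k) \<and>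
      3 * norm (y (Suc (Suc k)) - y (Suc k)) \<le> 2 * (Q k - Q (Suc k)) + norm (y (Suc k) - y k)"
  shows "dist (y n) c \<le> \<sigma>"
    and "(\<Sum>j<n. norm (y (Suc (Suc j)) - y (Suc j))) \<le> \<sigma> / 2"
proof -
  \<comment> \<open>\<open>step\<close> bounds only later steps; the first one is controlled by the
    initial gap \<open>g 0\<close> through descent.\<close>
  have "a * (norm (y 1 - y 0))\<^sup>2 \<le> a * (\<sigma> / 4)\<^sup>2"
    using descent g0 g1 by linarith
  then have "(norm (y 1 - y 0))\<^sup>2 \<le> (\<sigma> / 4)\<^sup>2"
    using \<open>0 < a\<close> by simp
  then have d0: "norm (y 1 - y 0) \<le> \<sigma> / 4"
    using power2_le_imp_le[of "norm (y 1 - y 0)" "\<sigma> / 4"] \<open>0 < \<sigma>\<close> by simp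
  have sums: "(\<Sum>j<k. norm (y (Suc (Suc j)) - y (Suc j))) \<le> \<sigma> / 2"
    if near: "\<And>j. j \<le> k \<Longrightarrow> dist (y j) c \<le> \<sigma>" for k
  \<comment> \<open>\<open>step\<close> gives the sign of \<open>Q k\<close> only for positive
    \<open>k\<close>.\<close>
  proof (cases k)
    case 0
    then show ?thesis using \<open>0 < \<sigma>\<close> by simp
  next
    case (Suc i)
    have "2 * (\<Sum>j<k. norm (y (Suc (Suc j)) - y (Suc j))) + norm (y (Suc k) - y k)
        \<le> 2 * (Q 0 - Q k) + norm (y (Suc 0) - y 0)"
      by (rule sum_le_telescope[where d = "\<lambda>j. norm (y (Suc j) - y j)"])
        (use near step in auto)
    moreover have "0 \<le> Q k" using step[of i] near Suc by simp
    moreover have "0 \<le> norm (y (Suc k) - y k)" by simp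
    moreover have "norm (y (Suc 0) - y 0) \<le> \<sigma> / 4" using d0 by simp
    \<comment> \<open>Twice the sum is at most \<open>2 * (\<sigma> / 4) + \<sigma> / 4\<close>,
      which leaves room below \<open>\<sigma>\<close>.\<close>
    ultimately show ?thesis
      using Q0 \<open>0 < \<sigma>\<close> by argo
  qed
  have trapped: "dist (y n) c \<le> \<sigma>" for n
  proof (induction n rule: less_induct)
    case (less n)
    consider "n = 0" | k where "n = Suc k" by (cases n) auto
    then show ?case
    proof cases
      case 1
      then show ?thesis using y0 \<open>0 < \<sigma>\<close> by simp
    next
      case 2
      have "dist (y n) c \<le> dist (y 1) c + (\<Sum>j<k. norm (y (Suc (Suc j)) - y (Suc j)))"
        using dist_le_sum_steps[of y 1 k c] 2 by (simp add: dist_norm)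
      also have "\<dots> \<le> \<sigma> / 4 + \<sigma> / 2"
        using y1 sums[of k] less 2 by (intro add_mono) auto
      finally show ?thesis using \<open>0 < \<sigma>\<close> by simp
    qed
  qed
  show "dist (y n) c \<le> \<sigma>" by (rule trapped)
  show "(\<Sum>j<n. norm (y (Suc (Suc j)) - y (Suc j))) \<le> \<sigma> / 2" by (rule sums) (rule trapped)
qed

text \<open>The analytic core, with all constants fixed. On the \<open>R\<close>-ball around
  \<open>(c, c)\<close> the function is at least \<open>m\<close> and the KL inequality holds;
  \<open>\<rho>\<close> and \<open>\<nu>\<close> come from the growth condition for
  \<open>R / 2\<close>; the components are trapped within \<open>\<sigma>\<close> of
  \<open>c\<close>, hence pairs within \<open>2 * \<sigma>\<close>; \<open>\<mu>\<close> bounds the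
  initial gap.\<close>

lemma KL_sequence_converges:
  fixes F :: "'b::euclidean_space \<times> 'b \<Rightarrow> ereal" and x :: "int \<Rightarrow> 'b"
  assumes "0 < a" "0 < b" and proper: "proper_fun F" and lsc: "lower_semicontinuous F"
    and Fzs: "F (c, c) = ereal m"
    and min: "\<And>z. dist z (c, c) \<le> R \<Longrightarrow> ereal m \<le> F z"
    and desing: "desingularizing \<eta> \<phi>"
    and KL: "\<And>z w. dist z (c, c) \<le> R \<Longrightarrow> ereal m < F z \<Longrightarrow> F z < ereal m + \<eta> \<Longrightarrow>
      w \<in> limiting_subdifferential F z \<Longrightarrow> 1 \<le> deriv \<phi> (real_of_ereal (F z) - m) * norm w"
    and growth: "\<And>z y. dist z (c, c) \<le> \<rho> \<Longrightarrow> F z < ereal (m + \<nu>) \<Longrightarrow> R / 2 < dist (snd y) c \<Longrightarrow>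
      F z < F y + ereal (a / 4 * (norm (snd z - snd y))\<^sup>2)"
    and \<sigma>: "0 < \<sigma>" "2 * \<sigma> \<le> \<rho>" "\<rho> < R"
    and \<mu>: "\<mu> \<le> \<nu>" "ereal \<mu> < \<eta>" "\<mu> \<le> a * (\<sigma> / 4)\<^sup>2"
    and \<phi>_small: "\<And>s. 0 \<le> s \<Longrightarrow> s < \<mu> \<Longrightarrow> b / a * \<phi> s \<le> \<sigma> / 4"
    and start: "dist (lifted_seq x 0) (c, c) \<le> \<sigma> / 4" "F (lifted_seq x 0) < ereal (m + \<mu>)"
    and descent: "sufficient_descent a F x" and rel: "relative_error b F x"
  shows "summable (\<lambda>k::nat. norm (x (int k + 1) - x (int k)))" (is ?summable)
    and "dist (lifted_seq x k) (c, c) \<le> 2 * \<sigma>"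
    and "\<exists>zbar. lifted_seq x \<longlonglongrightarrow> zbar \<and> dist zbar (c, c) \<le> 2 * \<sigma> \<and> F zbar = ereal m \<and>
      local_minimizer F zbar" (is ?limit)
proof -
  \<comment> \<open>The shift makes \<open>y 0\<close> the entry of index -1, so all indices are
    natural numbers.\<close>
  define y where "y n = x (int n - 1)" for n :: nat
  define d where "d n = norm (y (Suc n) - y n)" for n
  define g where "g k = real_of_ereal (F (lifted_seq x k)) - m" for k
  \<comment> \<open>The shift to \<open>g (Suc k)\<close> reflects that the relative error condition
    provides subgradients only from the second pair on.\<close>
  define Q where "Q k = b / a * \<phi> (g (Suc k))" for k
  have lift: "lifted_seq x k = (y (Suc k), y k)" for k
    by (simp add: lifted_seq_def y_def)
  have d_nonneg: "0 \<le> d k" for k by (simp add: d_def)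
  have ninf: "F z \<noteq> - \<infinity>" for z using proper unfolding proper_fun_def by blast

  \<comment> \<open>Gaps to the minimal value and the hypotheses at single iterates\<close>
  have descent_F: "F (lifted_seq x (Suc k)) + ereal (a * (d k)\<^sup>2) \<le> F (lifted_seq x k)" for k
    using descent by (simp add: sufficient_descent_def d_def y_def)
  have fin: "F (lifted_seq x k) \<noteq> \<infinity>" for k
  proof (induction k)
    case 0
    then show ?case using start(2) by auto
  next
    case (Suc k)
    then show ?case using descent_F[of k] by auto
  qed
  have Fg: "F (lifted_seq x k) = ereal (g k + m)" for k
    using fin[of k] ninf[of "lifted_seq x k"] by (cases "F (lifted_seq x k)") (auto simp: g_def)
  have g_descent: "g (Suc k) + a * (d k)\<^sup>2 \<le> g k" for k
    using descent_F[of k] by (simp add: Fg)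
  have g_Suc: "g (Suc k) \<le> g k" for k
  proof -
    have "0 \<le> a * (d k)\<^sup>2" using \<open>0 < a\<close> by simp
    then show ?thesis using g_descent[of k] by linarith
  qed
  have g_lt: "g k < \<mu>" for k
  proof (induction k)
    case 0
    then show ?case using start(2) by (simp add: Fg)
  next
    case (Suc k)
    then show ?case using g_Suc[of k] by simp
  qed
  have g_lt_\<eta>: "ereal (g k) < \<eta>" for k
    using g_lt[of k] \<mu>(2) less_trans[of "ereal (g k)" "ereal \<mu>" \<eta>] by simp
  have Fg_lt_\<eta>: "F (lifted_seq x k) < ereal m + \<eta>" for k
    using g_lt_\<eta>[of k] by (cases \<eta>) (auto simp: Fg)
  have \<phi>_nonneg: "0 \<le> \<phi> (g k)" if "0 \<le> g k" for k
    using desing that g_lt_\<eta>[of k] by (simp add: desingularizing_def)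
  have deriv_pos: "0 < deriv \<phi> (g k)" if "0 < g k" for k
    using desing that g_lt_\<eta>[of k] by (simp add: desingularizing_def)
  have KL_g: "1 \<le> deriv \<phi> (g k) * norm w"
    if "dist (lifted_seq x k) (c, c) \<le> R" "0 < g k" "w \<in> limiting_subdifferential F (lifted_seq x k)" for k w
    using KL[of "lifted_seq x k" w] that Fg_lt_\<eta>[of k] by (simp add: Fg)
  have g_nonneg: "0 \<le> g k" if "dist (lifted_seq x k) (c, c) \<le> R" for k
    using min[OF that] by (simp add: Fg)
  have rel_w: "\<exists>w \<in> limiting_subdifferential F (lifted_seq x (Suc k)). norm w \<le> b / 2 * (d k + d (Suc k))" for k
    using rel by (simp add: relative_error_def d_def y_def add.commute)

  \<comment> \<open>The telescoping inequality from the KL property\<close>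
  have KL_telescope: "3 * d (Suc k) \<le> 2 * (Q k - Q (Suc k)) + d k"
    if in1: "dist (lifted_seq x (Suc k)) (c, c) \<le> R" and in2: "dist (lifted_seq x (Suc (Suc k))) (c, c) \<le> R"
    for k
  proof (cases "g (Suc k) = 0")
    \<comment> \<open>The KL inequality speaks only of values above \<open>m\<close>. If
      \<open>m\<close> is already attained, descent and minimality force the next step to
      vanish.\<close>
    case True
    have "a * (d (Suc k))\<^sup>2 \<le> 0" and "g (Suc (Suc k)) = 0"
      using g_descent[of "Suc k"] g_nonneg[OF in2] g_Suc[of "Suc k"] True by auto
    then have "d (Suc k) = 0" using \<open>0 < a\<close> by (simp add: mult_le_0_iff)
    then show ?thesis using True \<open>g (Suc (Suc k)) = 0\<close> d_nonneg[of k] by (simp add: Q_def)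
  next
    case False
    then have pos: "0 < g (Suc k)" using g_nonneg[OF in1] by simp
    obtain w where w: "w \<in> limiting_subdifferential F (lifted_seq x (Suc k))"
      "norm w \<le> b / 2 * (d k + d (Suc k))" using rel_w by blast
    have "1 \<le> deriv \<phi> (g (Suc k)) * norm w" by (rule KL_g[OF in1 pos w(1)])
    also have "\<dots> \<le> deriv \<phi> (g (Suc k)) * (b / 2 * (d k + d (Suc k)))"
      by (rule mult_left_mono[OF w(2) less_imp_le[OF deriv_pos[OF pos]]])
    finally have "1 \<le> deriv \<phi> (g (Suc k)) * (b / 2 * (d k + d (Suc k)))" .
    \<comment> \<open>Concavity needs the later gap in the domain of \<open>\<phi>\<close>; its
      nonnegativity comes from \<open>in2\<close>.\<close>
    moreover have "deriv \<phi> (g (Suc k)) * (g (Suc k) - g (Suc (Suc k))) \<le> \<phi> (g (Suc k)) - \<phi> (g (Suc (Suc k)))"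
      by (rule desingularizing_above_tangent[OF desing pos g_lt_\<eta> g_nonneg[OF in2] g_lt_\<eta>])
    moreover have "a * (d (Suc k))\<^sup>2 \<le> g (Suc k) - g (Suc (Suc k))"
      using g_descent[of "Suc k"] by simp
    ultimately have "3 * d (Suc k) \<le> 2 * (b / a * (\<phi> (g (Suc k)) - \<phi> (g (Suc (Suc k))))) + d k"
      using KL_step[OF \<open>0 < a\<close> \<open>0 < b\<close> d_nonneg d_nonneg _ deriv_pos[OF pos]] by blast
    then show ?thesis by (simp add: Q_def right_diff_distrib)
  qed

  \<comment> \<open>The growth condition keeps the next two pairs in the neighbourhood\<close>
  have near: "dist (lifted_seq x k) (c, c) \<le> 2 * \<sigma>" if "dist (y k) c \<le> \<sigma>" "dist (y (Suc k)) c \<le> \<sigma>" for k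
    using dist_Pair_le[of "y (Suc k)" "y k" c c] that by (simp add: lift)
  \<comment> \<open>Assumption \<open>n\<close> contradicts the conclusion of the growth condition
    for the pairs of index \<open>k\<close> and \<open>k + n\<close>, whose second components are
    \<open>y k\<close> and \<open>y (k + n)\<close>.\<close>
  have stay: "dist (y (k + n)) c \<le> R / 2"
    if "dist (y k) c \<le> \<sigma>" "dist (y (Suc k)) c \<le> \<sigma>"
      and n: "g (k + n) + a / 4 * (norm (y k - y (k + n)))\<^sup>2 \<le> g k" for k n
  proof (rule ccontr)
    assume "\<not> dist (y (k + n)) c \<le> R / 2"
    moreover have "dist (lifted_seq x k) (c, c) \<le> \<rho>" using near that \<sigma> by fastforce
    moreover have "F (lifted_seq x k) < ereal (m + \<nu>)"
      using g_lt[of k] \<mu>(1) by (simp add: Fg)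
    ultimately have "F (lifted_seq x k) < F (lifted_seq x (k + n)) + ereal (a / 4 * (norm (y k - y (k + n)))\<^sup>2)"
      using growth[of "lifted_seq x k" "lifted_seq x (k + n)"] by (simp add: lift)
    then show False using n by (simp add: Fg)
  qed
  \<comment> \<open>The two pairs have components \<open>y (k + 1)\<close>,
    \<open>y (k + 2)\<close>, \<open>y (k + 3)\<close>. Each is within \<open>R / 2\<close> of
    \<open>c\<close>: the first by assumption, the others by \<open>stay\<close>.\<close>
  have in_nbhd: "dist (lifted_seq x (Suc k)) (c, c) \<le> R \<and> dist (lifted_seq x (Suc (Suc k))) (c, c) \<le> R"
    if near: "dist (y k) c \<le> \<sigma>" "dist (y (Suc k)) c \<le> \<sigma>" for k
  proof -
    have "norm (y k - y (k + 2)) \<le> d k + d (Suc k)"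
      using norm_triangle_ineq[of "y (Suc k) - y k" "y (Suc (Suc k)) - y (Suc k)"]
      by (simp add: d_def norm_minus_commute)
    then have "(norm (y k - y (k + 2)))\<^sup>2 \<le> (d k + d (Suc k))\<^sup>2"
      by (intro power_mono) auto
    also have "\<dots> \<le> 2 * ((d k)\<^sup>2 + (d (Suc k))\<^sup>2)" by (rule sum_squares2_le)
    \<comment> \<open>The factor 4 cancels the \<open>a / 4\<close> of the growth condition, leaving
      the sum of the descent terms.\<close>
    also have "\<dots> \<le> 4 * ((d k)\<^sup>2 + (d (Suc k))\<^sup>2)" by simp
    finally have "a / 4 * (norm (y k - y (k + 2)))\<^sup>2 \<le> a * ((d k)\<^sup>2 + (d (Suc k))\<^sup>2)"
      using \<open>0 < a\<close> by simp
    then have "g (k + 2) + a / 4 * (norm (y k - y (k + 2)))\<^sup>2 \<le> g k"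
      using g_descent[of k] g_descent[of "Suc k"] by (simp add: distrib_left)
    then have two: "dist (y (Suc (Suc k))) c \<le> R / 2"
      using stay[OF near, of 2] by simp
    have "norm (y k - y (k + 3)) \<le> d k + d (Suc k) + d (Suc (Suc k))"
      using norm_triangle_ineq[of "y (Suc k) - y k" "y (Suc (Suc k)) - y (Suc k)"]
        norm_triangle_ineq[of "y (Suc (Suc k)) - y k" "y (Suc (Suc (Suc k))) - y (Suc (Suc k))"]
      by (simp add: d_def norm_minus_commute numeral_3_eq_3)
    then have "(norm (y k - y (k + 3)))\<^sup>2 \<le> (d k + d (Suc k) + d (Suc (Suc k)))\<^sup>2"
      by (intro power_mono) auto
    also have "\<dots> \<le> 3 * ((d k)\<^sup>2 + (d (Suc k))\<^sup>2 + (d (Suc (Suc k)))\<^sup>2)" by (rule sum_squares3_le)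
    also have "\<dots> \<le> 4 * ((d k)\<^sup>2 + (d (Suc k))\<^sup>2 + (d (Suc (Suc k)))\<^sup>2)" by simp
    finally have "a / 4 * (norm (y k - y (k + 3)))\<^sup>2 \<le> a * ((d k)\<^sup>2 + (d (Suc k))\<^sup>2 + (d (Suc (Suc k)))\<^sup>2)"
      using \<open>0 < a\<close> by simp
    then have "g (k + 3) + a / 4 * (norm (y k - y (k + 3)))\<^sup>2 \<le> g k"
      using g_descent[of k] g_descent[of "Suc k"] g_descent[of "Suc (Suc k)"]
      by (simp add: distrib_left numeral_3_eq_3)
    then have three: "dist (y (Suc (Suc (Suc k)))) c \<le> R / 2"
      using stay[OF near, of 3] by (simp add: numeral_3_eq_3)
    show ?thesis
      using dist_Pair_le[of "y (Suc (Suc k))" "y (Suc k)" c c]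
        dist_Pair_le[of "y (Suc (Suc (Suc k)))" "y (Suc (Suc k))" c c] two three near \<sigma>
      by (simp add: lift)
  qed

  \<comment> \<open>Trapping the whole sequence\<close>
  have y01: "dist (y 0) c \<le> \<sigma> / 4" "dist (y 1) c \<le> \<sigma> / 4"
    using start(1) dist_snd_le[of "lifted_seq x 0" "(c, c)"] dist_fst_le[of "lifted_seq x 0" "(c, c)"]
    by (simp_all add: lift)
  \<comment> \<open>The second pair is already in the \<open>R\<close>-ball by the growth argument
    at \<open>k = 0\<close>, before any trapping.\<close>
  have g1: "0 \<le> g 1"
    using g_nonneg[of 1] in_nbhd[of 0] y01 \<sigma>(1) by simp
  have step: "0 \<le> Q (Suc k) \<and>
      3 * norm (y (Suc (Suc k)) - y (Suc k)) \<le> 2 * (Q k - Q (Suc k)) + norm (y (Suc k) - y k)"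
    if "dist (y k) c \<le> \<sigma>" "dist (y (Suc k)) c \<le> \<sigma>" for k
  proof
    show "0 \<le> Q (Suc k)"
      using in_nbhd[OF that] g_nonneg \<phi>_nonneg \<open>0 < a\<close> \<open>0 < b\<close> by (simp add: Q_def)
    show "3 * norm (y (Suc (Suc k)) - y (Suc k)) \<le> 2 * (Q k - Q (Suc k)) + norm (y (Suc k) - y k)"
      using KL_telescope in_nbhd[OF that] by (simp add: d_def)
  qed
  have g0: "g 0 \<le> a * (\<sigma> / 4)\<^sup>2" using g_lt[of 0] \<mu>(3) by simp
  have Q0: "Q 0 \<le> \<sigma> / 4" using \<phi>_small[of "g 1"] g1 g_lt[of 1] by (simp add: Q_def)
  have first: "g 1 + a * (norm (y 1 - y 0))\<^sup>2 \<le> g 0" using g_descent[of 0] by (simp add: d_def)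
  note trap = iterates_trapped[where y = y and c = c and g = g and Q = Q,
      OF \<open>0 < a\<close> \<sigma>(1) y01 first g0 g1 Q0 step]
  have trapped: "dist (y n) c \<le> \<sigma>"
    and sums: "(\<Sum>j<n. norm (y (Suc (Suc j)) - y (Suc j))) \<le> \<sigma> / 2" for n
    by (rule trap; assumption)+

  \<comment> \<open>Finite length and convergence\<close>
  have z_near: "dist (lifted_seq x k) (c, c) \<le> 2 * \<sigma>" for k
    using near trapped by blast
  then show "dist (lifted_seq x k) (c, c) \<le> 2 * \<sigma>" .
  have z_R: "dist (lifted_seq x k) (c, c) \<le> R" for k
    using z_near[of k] \<sigma> by simp
  have "summable (\<lambda>j. norm (y (Suc (Suc j)) - y (Suc j)))"
    using sums by (intro summableI_nonneg_bounded[where x = "\<sigma> / 2"]) simp_all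
  moreover have "norm (x (int k + 1) - x (int k)) = norm (y (Suc (Suc k)) - y (Suc k))" for k :: nat
    by (simp add: y_def add.commute)
  ultimately show ?summable by simp
  \<comment> \<open>The trapped sums begin with \<open>y 2 - y 1\<close>; the missing first step is
    restored here.\<close>
  have sd: "summable (\<lambda>j. norm (y (Suc j) - y j))"
    using \<open>summable (\<lambda>j. norm (y (Suc (Suc j)) - y (Suc j)))\<close>
    by (subst (asm) summable_Suc_iff[where f = "\<lambda>j. norm (y (Suc j) - y j)"])
  then obtain l where l: "y \<longlonglongrightarrow> l"
    using summable_norm_steps_imp_convergent convergentD by blast
  have lim: "lifted_seq x \<longlonglongrightarrow> (l, l)"
    using tendsto_Pair[OF LIMSEQ_Suc[OF l] l] by (simp add: lift[abs_def])
  have dist_l: "dist (l, l) (c, c) \<le> 2 * \<sigma>"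
    using LIMSEQ_le_const2[OF tendsto_dist[OF lim tendsto_const[of "(c, c)"]]] z_near by blast
  have d0: "d \<longlonglongrightarrow> 0"
    using summable_LIMSEQ_zero[OF sd] by (simp add: d_def[abs_def])

  \<comment> \<open>Value and minimality of the limit\<close>
  have "decseq g" using g_Suc by (simp add: decseq_Suc_iff)
  then obtain L where L: "g \<longlonglongrightarrow> L" and L_le: "\<And>k. L \<le> g k"
    using decseq_convergent[of g 0] g_nonneg[OF z_R] by blast
  have "0 \<le> L"
    using LIMSEQ_le_const[OF L] g_nonneg[OF z_R] by blast
  \<comment> \<open>If \<open>L\<close> were positive, it would lie strictly between 0 and
    \<open>\<eta>\<close>, so the slopes \<open>deriv \<phi> (g k)\<close> would converge to a
    finite value while the subgradient bounds tend to 0; their product could not stay at least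
    1.\<close>
  have "L = 0"
  proof (rule ccontr)
    assume "L \<noteq> 0"
    with \<open>0 \<le> L\<close> have "0 < L" by simp
    then have pos: "0 < g k" for k using L_le[of k] by simp
    have "ereal L < \<eta>" using L_le[of 0] g_lt_\<eta>[of 0] le_less_trans[of "ereal L" "ereal (g 0)" \<eta>] by simp
    then have "(\<lambda>k. deriv \<phi> (g k)) \<longlonglongrightarrow> deriv \<phi> L"
      using desing \<open>0 < L\<close> L pos g_lt_\<eta>
      by (intro continuous_on_tendsto_compose[of "{s. 0 < s \<and> ereal s < \<eta>}" "deriv \<phi>" g L])
        (auto simp: desingularizing_def)
    then have lim0: "(\<lambda>k. deriv \<phi> (g (Suc k)) * (b / 2 * (d k + d (Suc k)))) \<longlonglongrightarrow> deriv \<phi> L * (b / 2 * (0 + 0))"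
      by (intro tendsto_intros d0 LIMSEQ_Suc[OF d0]) (rule LIMSEQ_Suc)
    have ge1: "1 \<le> deriv \<phi> (g (Suc k)) * (b / 2 * (d k + d (Suc k)))" for k
    proof -
      obtain w where w: "w \<in> limiting_subdifferential F (lifted_seq x (Suc k))"
        "norm w \<le> b / 2 * (d k + d (Suc k))" using rel_w by blast
      have "1 \<le> deriv \<phi> (g (Suc k)) * norm w" by (rule KL_g[OF z_R pos w(1)])
      also have "\<dots> \<le> deriv \<phi> (g (Suc k)) * (b / 2 * (d k + d (Suc k)))"
        by (rule mult_left_mono[OF w(2) less_imp_le[OF deriv_pos[OF pos]]])
      finally show ?thesis .
    qed
    have "1 \<le> deriv \<phi> L * (b / 2 * (0 + 0))"
      by (rule LIMSEQ_le_const[OF lim0]) (intro exI allI impI ge1)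
    then show False by simp
  qed
  then have "(\<lambda>k. F (lifted_seq x k)) \<longlonglongrightarrow> ereal m"
    using tendsto_add[OF L tendsto_const[of m]] by (simp add: Fg)
  then have "F (l, l) \<le> ereal m"
    by (rule lower_semicontinuous_le_lim[OF lsc lim])
  moreover have "ereal m \<le> F (l, l)" using min dist_l \<sigma> by simp
  ultimately have Fl: "F (l, l) = ereal m" by (rule antisym)
  \<comment> \<open>Since \<open>2 * \<sigma> < R\<close>, the limit is interior to the ball on
    which \<open>F\<close> is at least \<open>m\<close>, its own value there.\<close>
  have "\<forall>\<^sub>F z in nhds (l, l). z \<in> ball (c, c) R"
    using dist_l \<sigma> by (intro eventually_nhds_in_open) (auto simp: dist_commute)
  then have "\<forall>\<^sub>F z in nhds (l, l). F (l, l) \<le> F z"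
    by (rule eventually_mono) (simp add: Fl min dist_commute)
  then have "local_minimizer F (l, l)"
    using Fl by (simp add: local_minimizer_def effective_domain_def)
  then show ?limit using lim dist_l Fl by blast
qed

theorem theorem11:
  fixes a b :: real
    and F :: "(real ^ 'n) \<times> (real ^ 'n) \<Rightarrow> ereal"
    and xs :: "real ^ 'n" and zs :: "(real ^ 'n) \<times> (real ^ 'n)"
  assumes "a > 0" and "b > 0"
    and "proper_fun F" and "lower_semicontinuous F"
    and "zs = (xs, xs)" and "local_minimizer F zs"
    and "KL_property F zs"
    and "growth_condition a F zs"
  shows "\<exists>r\<^sub>0>0. \<forall>r>0. \<exists>u \<mu>. 0 < u \<and> u < r \<and> 0 < (\<mu>::real) \<and>
    (\<forall>x :: int \<Rightarrow> real ^ 'n.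
        lifted_seq x 0 \<in> cball zs u \<and>
        F zs < F (lifted_seq x 0) \<and> F (lifted_seq x 0) < F zs + ereal \<mu> \<and>
        sufficient_descent a F x \<and> relative_error b F x \<longrightarrow>
          summable (\<lambda>k::nat. norm (x (int k + 1) - x (int k))) \<and>
          (\<forall>k. lifted_seq x k \<in> cball zs r) \<and>
          (\<exists>zbar \<in> cball zs r.
              lifted_seq x \<longlonglongrightarrow> zbar \<and> critical_point F zbar \<and> F zbar = F zs \<and>
              (r < r\<^sub>0 \<longrightarrow> local_minimizer F zbar)))"
proof -
  have "F zs < \<infinity>" using assms(6) by (simp add: local_minimizer_def effective_domain_def)
  moreover have "F zs \<noteq> - \<infinity>" using assms(3) unfolding proper_fun_def by blast
  ultimately obtain m where m: "F zs = ereal m" by (cases "F zs") auto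
  obtain V where V: "open V" "zs \<in> V" "\<And>z. z \<in> V \<Longrightarrow> F zs \<le> F z"
    using assms(6) unfolding local_minimizer_def eventually_nhds by blast
  obtain \<eta> U \<phi> where U: "0 < \<eta>" "open U" "zs \<in> U" and desing: "desingularizing \<eta> \<phi>"
    and KL: "\<And>z. z \<in> U \<Longrightarrow> F zs < F z \<Longrightarrow> F z < F zs + \<eta> \<Longrightarrow>
           1 \<le> ereal (deriv \<phi> (real_of_ereal (F z - F zs))) *
             (INF v\<in>limiting_subdifferential F z. ereal (norm v))"
    using assms(7) unfolding KL_property_def by blast
  obtain R where R: "0 < R" "cball zs R \<subseteq> U \<inter> V"
    using U V open_contains_cball[of "U \<inter> V"] by (metis IntI open_Int)
  have minR: "ereal m \<le> F z" if "dist z (xs, xs) \<le> R" for z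
    using V(3)[of z] R(2) that m assms(5) by (auto simp: dist_commute)
  have KLR: "1 \<le> deriv \<phi> (real_of_ereal (F z) - m) * norm w"
    if z: "dist z (xs, xs) \<le> R" "ereal m < F z" "F z < ereal m + \<eta>"
      and w: "w \<in> limiting_subdifferential F z" for z w
  proof -
    obtain t where t: "F z = ereal t" using z by (cases "F z") auto
    have "z \<in> U" using R(2) z(1) assms(5) by (auto simp: dist_commute)
    then have "1 \<le> ereal (deriv \<phi> (t - m)) * (INF v\<in>limiting_subdifferential F z. ereal (norm v))"
      using KL[of z] z by (simp add: m t)
    moreover have "ereal (t - m) < \<eta>" using z(3) t by (cases \<eta>) auto
    then have "0 < deriv \<phi> (t - m)"
      using desing z(2) t by (simp add: desingularizing_def)
    ultimately show ?thesis using KL_ineq_at_subgradient w t by fastforce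
  qed
  \<comment> \<open>The growth condition is taken with \<open>\<delta> = R / 2\<close>, so that two
    component distances add up to at most \<open>R\<close>.\<close>
  obtain \<rho> \<nu> where \<rho>: "0 < \<rho>" "\<rho> < R / 2" "0 < \<nu>"
    and growth: "\<And>z y. z \<in> cball zs \<rho> \<Longrightarrow> F z < F zs + ereal \<nu> \<Longrightarrow> snd y \<notin> cball (snd zs) (R / 2) \<Longrightarrow>
           F z < F y + ereal (a / 4 * (norm (snd z - snd y))\<^sup>2)"
    using assms(8) R(1) unfolding growth_condition_def by (metis half_gt_zero)
  have growth': "F z < F y + ereal (a / 4 * (norm (snd z - snd y))\<^sup>2)"
    if "dist z (xs, xs) \<le> \<rho>" "F z < ereal (m + \<nu>)" "R / 2 < dist (snd y) xs" for z y
    using growth[of z y] that m assms(5) by (simp add: dist_commute)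
  \<comment> \<open>A real level below the possibly infinite \<open>\<eta>\<close>;
    \<open>\<mu>\<close> will be kept below it.\<close>
  obtain h where h: "0 < h" "ereal h < \<eta>"
    using ereal_dense2[OF U(1)] by (auto simp: zero_ereal_def)
  have "\<exists>u \<mu>. 0 < u \<and> u < r \<and> 0 < (\<mu>::real) \<and>
    (\<forall>x :: int \<Rightarrow> real ^ 'n.
        lifted_seq x 0 \<in> cball zs u \<and>
        F zs < F (lifted_seq x 0) \<and> F (lifted_seq x 0) < F zs + ereal \<mu> \<and>
        sufficient_descent a F x \<and> relative_error b F x \<longrightarrow>
          summable (\<lambda>k::nat. norm (x (int k + 1) - x (int k))) \<and>
          (\<forall>k. lifted_seq x k \<in> cball zs r) \<and>
          (\<exists>zbar \<in> cball zs r.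
              lifted_seq x \<longlonglongrightarrow> zbar \<and> critical_point F zbar \<and> F zbar = F zs \<and>
              (r < 1 \<longrightarrow> local_minimizer F zbar)))"
    if "0 < r" for r :: real
  proof -
    \<comment> \<open>Then \<open>2 * \<sigma>\<close>, the trapping radius for pairs, is at most
      both \<open>r\<close> and \<open>\<rho>\<close>.\<close>
    define \<sigma> where "\<sigma> = min r \<rho> / 2"
    have \<sigma>: "0 < \<sigma>" "2 * \<sigma> \<le> \<rho>" "2 * \<sigma> \<le> r" "\<rho> < R"
      using that \<rho> R(1) by (auto simp: \<sigma>_def)
    have "continuous_on {s. 0 \<le> s \<and> ereal s < \<eta>} \<phi>" "\<phi> 0 = 0"
      using desing by (auto simp: desingularizing_def)
    moreover have "0 \<in> {s. 0 \<le> s \<and> ereal s < \<eta>}"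
      using U(1) by (simp flip: zero_ereal_def)
    moreover have "0 < a / b * (\<sigma> / 4)" using assms \<sigma> by simp
    \<comment> \<open>Continuity of \<open>\<phi>\<close> at 0; the bound is
      \<open>\<sigma> / 4\<close> after multiplication by \<open>b / a\<close>.\<close>
    ultimately obtain e where e: "0 < e"
      "\<And>s. 0 \<le> s \<Longrightarrow> ereal s < \<eta> \<Longrightarrow> dist s 0 < e \<Longrightarrow> dist (\<phi> s) 0 < a / b * (\<sigma> / 4)"
      unfolding continuous_on_iff by (metis (mono_tags, lifting) mem_Collect_eq)
    \<comment> \<open>The four bounds serve the growth condition, the smallness of
      \<open>\<phi>\<close>, the domain of \<open>\<phi>\<close> and the length of the first
      step.\<close>
    define \<mu> where "\<mu> = min (min \<nu> e) (min h (a * (\<sigma> / 4)\<^sup>2))"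
    have \<mu>: "0 < \<mu>" "\<mu> \<le> \<nu>" "\<mu> \<le> e" "\<mu> \<le> h" "\<mu> \<le> a * (\<sigma> / 4)\<^sup>2"
      using \<rho> e h assms \<sigma> by (auto simp: \<mu>_def)
    have \<mu>\<eta>: "ereal \<mu> < \<eta>"
      using \<mu>(4) h(2) le_less_trans[of "ereal \<mu>" "ereal h" \<eta>] by simp
    have \<phi>_small: "b / a * \<phi> s \<le> \<sigma> / 4" if "0 \<le> s" "s < \<mu>" for s
    proof -
      have "ereal s < \<eta>" using \<mu>\<eta> that less_trans[of "ereal s" "ereal \<mu>" \<eta>] by simp
      then have "\<phi> s \<le> a / b * (\<sigma> / 4)" using e(2)[of s] that \<mu> by simp
      then have "b / a * \<phi> s \<le> b / a * (a / b * (\<sigma> / 4))"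
        using assms by (intro mult_left_mono) auto
      then show ?thesis using assms by simp
    qed
    have "summable (\<lambda>k::nat. norm (x (int k + 1) - x (int k))) \<and>
          (\<forall>k. lifted_seq x k \<in> cball zs r) \<and>
          (\<exists>zbar \<in> cball zs r.
              lifted_seq x \<longlonglongrightarrow> zbar \<and> critical_point F zbar \<and> F zbar = F zs \<and>
              (r < 1 \<longrightarrow> local_minimizer F zbar))"
      if x: "lifted_seq x 0 \<in> cball zs (\<sigma> / 4)" "F (lifted_seq x 0) < F zs + ereal \<mu>"
        "sufficient_descent a F x" "relative_error b F x" for x
    proof -
      have start: "dist (lifted_seq x 0) (xs, xs) \<le> \<sigma> / 4" "F (lifted_seq x 0) < ereal (m + \<mu>)"
        using x m assms(5) by (simp_all add: dist_commute)
      have Fxs: "F (xs, xs) = ereal m" using m assms(5) by simp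
      note conv = KL_sequence_converges[OF assms(1-4) Fxs minR desing KLR growth' \<sigma>(1,2,4) \<mu>(2) \<mu>\<eta> \<mu>(5)
          \<phi>_small start x(3,4)]
      obtain zbar where zbar: "lifted_seq x \<longlonglongrightarrow> zbar" "dist zbar (xs, xs) \<le> 2 * \<sigma>" "F zbar = ereal m"
        "local_minimizer F zbar" using conv(3) by blast
      have "\<forall>k. lifted_seq x k \<in> cball zs r"
      proof
        fix k
        show "lifted_seq x k \<in> cball zs r"
          using order_trans[OF conv(2)[of k] \<sigma>(3)] assms(5) by (simp add: dist_commute)
      qed
      moreover have "zbar \<in> cball zs r" using zbar(2) \<sigma>(3) assms(5) by (simp add: dist_commute)
      ultimately show ?thesis
        using conv(1) zbar m local_minimizer_imp_critical_point[OF assms(3) zbar(4)]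
        by (intro conjI bexI[of _ zbar]) simp_all
    qed
    then have "\<forall>x :: int \<Rightarrow> real ^ 'n.
        lifted_seq x 0 \<in> cball zs (\<sigma> / 4) \<and>
        F zs < F (lifted_seq x 0) \<and> F (lifted_seq x 0) < F zs + ereal \<mu> \<and>
        sufficient_descent a F x \<and> relative_error b F x \<longrightarrow>
          summable (\<lambda>k::nat. norm (x (int k + 1) - x (int k))) \<and>
          (\<forall>k. lifted_seq x k \<in> cball zs r) \<and>
          (\<exists>zbar \<in> cball zs r.
              lifted_seq x \<longlonglongrightarrow> zbar \<and> critical_point F zbar \<and> F zbar = F zs \<and>
              (r < 1 \<longrightarrow> local_minimizer F zbar))"
      by blast
    \<comment> \<open>The witness for \<open>u\<close> is \<open>\<sigma> / 4\<close>, which puts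
      both components of the starting pair within \<open>\<sigma> / 4\<close> of
      \<open>xs\<close>.\<close>
    moreover have "0 < \<sigma> / 4" "\<sigma> / 4 < r" using \<sigma> by auto
    ultimately show ?thesis using \<mu>(1) by blast
  qed
  \<comment> \<open>The cap of \<open>\<sigma>\<close> by \<open>\<rho>\<close> keeps the limit near
    \<open>zs\<close> for every \<open>r\<close>, so 1 can serve as the threshold.\<close>
  then show ?thesis by (intro exI[of _ 1]) simp
qed

end
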